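(* For each integer $n\ge1$ let $\beta=\beta(n),\gamma=\gamma(n)\in[0,2)$ with $\beta+\gamma<2$, let $\delta=\delta(n)=\max\{\beta,\gamma\}$, and let $\mathcal{U}^{\beta,\gamma}_{n+1}$ be the set of $n+1$ $(\beta,\gamma)$-Chebyshev-Lobatto points. If $$\delta<\frac{4}{\pi n^2\,(2+\pi\log(n+1))}$$ for every $n$, then $$\Lambda(\mathcal{U}^{\beta,\gamma}_{n+1},\Omega)=\mathcal{O}(\log n)\quad\text{as } n\to\infty.$$
   Context: Let $\Omega=[-1,1]$. For $\beta,\gamma\in[0,2)$ with $\beta+\gamma<2$ and an integer $n\ge1$, $$\mathcal{U}^{\beta,\gamma}_{n+1}=\Big\{\cos\Big(\frac{(2-\beta-\gamma)j\pi}{2n}+\frac{\gamma\pi}{2}\Big)\Big\}_{j=0,\dots,n}.$$ For a set $\mathcal{X}=\{x_0,\dots,x_n\}\subset\Omega$ of distinct points, with Lagrange polynomials $\ell_i(x)=\prod_{j\ne i}\frac{x-x_j}{x_i-x_j}$, the Lebesgue constant is $\Lambda(\mathcal{X},\Omega)=\max_{x\in\Omega}\sum_{i=0}^n|\ell_i(x)|$. Here $\log$ is the natural logarithm. *)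

theory Defs
  imports "HOL-Analysis.Analysis" "HOL-Library.Landau_Symbols"
begin

text \<open>The set with index \<open>n\<close> consists of \<open>n + 1\<close> points.\<close>

definition cheb_lobatto :: "real \<Rightarrow> real \<Rightarrow> nat \<Rightarrow> real set" where
  "cheb_lobatto \<beta> \<gamma> n =
     (\<lambda>j. cos ((2 - \<beta> - \<gamma>) * real j * pi / (2 * real n) + \<gamma> * pi / 2)) ` {0..n}"

text \<open>The Lagrange polynomials are indexed by the nodes themselves, since the nodes are distinct.\<close>

definition lagrange_basis :: "real set \<Rightarrow> real \<Rightarrow> real \<Rightarrow> real" where
  "lagrange_basis X a x = (\<Prod>b\<in>X - {a}. (x - b) / (a - b))"

text \<open>For finite \<open>X\<close> and nonempty compact \<open>\<Omega>\<close> the supremum is a maximum, see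
  \<open>lebesgue_constant_attained\<close> below.\<close>

definition lebesgue_constant :: "real set \<Rightarrow> real set \<Rightarrow> real" where
  "lebesgue_constant X \<Omega> = (SUP x\<in>\<Omega>. \<Sum>a\<in>X. \<bar>lagrange_basis X a x\<bar>)"

lemma lebesgue_constant_attained:
  assumes "compact \<Omega>" "\<Omega> \<noteq> {}"
  obtains x where "x \<in> \<Omega>" "lebesgue_constant X \<Omega> = (\<Sum>a\<in>X. \<bar>lagrange_basis X a x\<bar>)"
    "\<And>y. y \<in> \<Omega> \<Longrightarrow> (\<Sum>a\<in>X. \<bar>lagrange_basis X a y\<bar>) \<le> lebesgue_constant X \<Omega>"
proof -
  let ?f = "\<lambda>x. \<Sum>a\<in>X. \<bar>lagrange_basis X a x\<bar>"
  have "continuous_on \<Omega> ?f"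
    unfolding lagrange_basis_def divide_inverse by (intro continuous_intros)
  then obtain x where x: "x \<in> \<Omega>" "\<And>y. y \<in> \<Omega> \<Longrightarrow> ?f y \<le> ?f x"
    using continuous_attains_sup[OF assms, of ?f] by blast
  have "lebesgue_constant X \<Omega> = ?f x"
    unfolding lebesgue_constant_def by (rule cSup_eq_maximum) (use x in auto)
  with x show thesis by (intro that) auto
qed

lemma card_cheb_lobatto:
  assumes "n \<ge> 1" "\<beta> \<ge> 0" "\<gamma> \<ge> 0" "\<beta> + \<gamma> < 2"
  shows "card (cheb_lobatto \<beta> \<gamma> n) = n + 1"
proof -
  let ?\<theta> = "\<lambda>j. (2 - \<beta> - \<gamma>) * real j * pi / (2 * real n) + \<gamma> * pi / 2"
  have range: "0 \<le> ?\<theta> j \<and> ?\<theta> j \<le> pi" if "j \<le> n" for j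
  proof
    show "0 \<le> ?\<theta> j" using assms by simp
    have "(2 - \<beta> - \<gamma>) * (real j / real n) \<le> (2 - \<beta> - \<gamma>) * 1"
      using assms that by (intro mult_left_mono) (auto simp: divide_simps)
    then have "((2 - \<beta> - \<gamma>) * (real j / real n) + \<gamma>) * (pi / 2) \<le> 2 * (pi / 2)"
      using assms by (intro mult_right_mono) auto
    then have le: "((2 - \<beta> - \<gamma>) * (real j / real n) + \<gamma>) * (pi / 2) \<le> pi" by linarith
    have eq: "c * real j * pi / (2 * real n) + \<gamma> * pi / 2 = (c * (real j / real n) + \<gamma>) * (pi / 2)" for c
      by (simp add: algebra_simps)
    show "?\<theta> j \<le> pi" unfolding eq by (rule le)
  qed
  define c where "c = (2 - \<beta> - \<gamma>) * pi / (2 * real n)"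
  have "c \<noteq> 0" using assms unfolding c_def by simp
  have \<theta>: "?\<theta> j = c * real j + \<gamma> * pi / 2" for j
    unfolding c_def by simp
  have "inj_on (\<lambda>j. cos (c * real j + \<gamma> * pi / 2)) {0..n}"
  proof (rule inj_onI)
    fix i j assume ij: "i \<in> {0..n}" "j \<in> {0..n}"
      and eq: "cos (c * real i + \<gamma> * pi / 2) = cos (c * real j + \<gamma> * pi / 2)"
    have "c * real i + \<gamma> * pi / 2 = c * real j + \<gamma> * pi / 2"
      by (rule cos_inj_pi) (use ij range[of i] range[of j] eq in \<open>auto simp only: \<theta> atLeastAtMost_iff\<close>)
    with \<open>c \<noteq> 0\<close> show "i = j" by simp
  qed
  then show ?thesis unfolding cheb_lobatto_def \<theta> by (simp add: card_image)
qed

end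

theory Submission
  imports Defs
begin

text \<open>For \<open>\<beta> = \<gamma> = 0\<close> the nodes are \<open>cos (i \<pi> / n)\<close>, and in the variable \<open>t = arccos x\<close> their Lagrange
  basis is a sum of two translates of \<open>sin (n t) cot (t / 2)\<close>. Hence the \<open>i\<close>-th basis function is
  bounded by a constant multiple of \<open>1 / (1 + \<bar>i - m\<bar>)\<close>, where \<open>t\<close> lies between the nodes \<open>m\<close> and
  \<open>m + 1\<close>, which gives the logarithmic bound; moreover it is \<open>n\<close>-Lipschitz in \<open>t\<close>.
  In general every node angle moves by at most \<open>\<epsilon> = \<delta> \<pi> / 2\<close>. If \<open>p\<close> has degree at most \<open>n\<close> and is
  bounded by 1 at the moved nodes, its maximum \<open>A\<close> over the unmoved nodes satisfies
  \<open>A \<le> 1 + (n + 1) n \<epsilon> A\<close>. The hypothesis makes \<open>(n + 1) n \<epsilon> \<le> 1 / 2\<close> for large \<open>n\<close>, so that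
  \<open>A \<le> 2\<close> and the Lebesgue constant at most doubles.\<close>

section \<open>The halved Dirichlet kernel: closed form, size, zeros, Lipschitz constant\<close>

text \<open>The Dirichlet kernel with its last term halved, \<open>sin (n t) cot (t / 2)\<close> in closed form.\<close>

definition lobatto_kernel :: "nat \<Rightarrow> real \<Rightarrow> real" where
  "lobatto_kernel n t = 1 + 2 * (\<Sum>k=1..<n. cos (real k * t)) + cos (real n * t)"

text \<open>Telescoping: passing from m to m + 1 adds cos (m t) + cos ((m + 1) t), and sin (t / 2)
  times this is (sin ((m + 1) t) - sin (m t)) cos (t / 2). The product form stays valid at the zeros
  of sin (t / 2).\<close>

lemma sin_half_mult_lobatto_kernel:
  assumes "n \<ge> 1"
  shows "sin (t / 2) * lobatto_kernel n t = sin (real n * t) * cos (t / 2)"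
  using assms
proof (induction n rule: dec_induct)
  case base
  define x where "x = t / 2"
  have t: "t = 2 * x" by (simp add: x_def)
  have "sin x * (1 + cos (2 * x)) = sin (2 * x) * cos x"
    unfolding cos_double_cos sin_double by (simp add: power2_eq_square)
  then show ?case by (simp add: lobatto_kernel_def t)
next
  case (step m)
  \<comment> \<open>Used with x = t / 2 and a the midpoint of m t and (m + 1) t.\<close>
  have split: "sin x * (cos (a - x) + cos (a + x)) = (sin (a + x) - sin (a - x)) * cos x"
    for a x :: real
    by (simp add: sin_add sin_diff cos_add cos_diff)
  have "lobatto_kernel (Suc m) t = lobatto_kernel m t + (cos (m * t) + cos (Suc m * t))"
    using step by (simp add: lobatto_kernel_def)
  moreover have "sin (t / 2) * (cos (m * t) + cos (Suc m * t))
      = (sin (Suc m * t) - sin (m * t)) * cos (t / 2)"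
    using split[of "t / 2" "m * t + t / 2"] by (simp add: algebra_simps)
  ultimately show ?case
    using step.IH by (simp add: algebra_simps)
qed

lemma lobatto_kernel_bound:
  assumes "n \<ge> 1"
  shows "\<bar>lobatto_kernel n t\<bar> \<le> 2 * real n"
proof -
  have "\<bar>\<Sum>k=1..<n. cos (real k * t)\<bar> \<le> (\<Sum>k=1..<n. 1)"
    by (intro order_trans[OF sum_abs] sum_mono) simp
  then have "\<bar>\<Sum>k=1..<n. cos (real k * t)\<bar> \<le> real n - 1"
    using assms by simp
  moreover have "\<bar>cos (real n * t)\<bar> \<le> 1" by simp
  ultimately show ?thesis unfolding lobatto_kernel_def by linarith
qed

lemma abs_lobatto_kernel_le_inverse_sin:
  assumes "n \<ge> 1" "s > 0" "s \<le> \<bar>sin (t / 2)\<bar>"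
  shows "\<bar>lobatto_kernel n t\<bar> \<le> 1 / s"
proof -
  have "s * \<bar>lobatto_kernel n t\<bar> \<le> \<bar>sin (t / 2)\<bar> * \<bar>lobatto_kernel n t\<bar>"
    using assms(3) by (intro mult_right_mono) auto
  also have "\<dots> = \<bar>sin (real n * t)\<bar> * \<bar>cos (t / 2)\<bar>"
    using sin_half_mult_lobatto_kernel[OF assms(1)] by (metis abs_mult)
  also have "\<dots> \<le> 1" by (intro mult_le_one) auto
  finally show ?thesis using assms(2) by (simp add: field_simps)
qed

text \<open>At multiples of 2 pi all cosines equal 1 and the sum is 1 + 2 (n - 1) + 1. At the other
  multiples of pi / n the closed form has sin (n t) = 0 while sin (t / 2) does not vanish. The index
  is an integer because differences of node indices can be negative.\<close>

lemma lobatto_kernel_node: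
  assumes "n \<ge> 1"
  shows "lobatto_kernel n (of_int j * pi / real n) = (if 2 * int n dvd j then 2 * real n else 0)"
proof (cases "2 * int n dvd j")
  case True
  then obtain m where j: "j = 2 * int n * m" by blast
  have one: "cos (real k * (of_int j * pi / real n)) = 1" for k
  proof -
    have "real k * (of_int j * pi / real n) = of_int (int k * m) * (2 * pi)"
      using assms by (simp add: j)
    then show ?thesis
      using cos_int_2pin[of "int k * m"] by (simp only: mult.commute)
  qed
  show ?thesis
    unfolding lobatto_kernel_def one using True assms by simp
next
  case False
  let ?t = "of_int j * pi / real n"
  have "sin (?t / 2) \<noteq> 0"
  proof
    assume "sin (?t / 2) = 0"
    then obtain m where "?t / 2 = of_int m * pi" unfolding sin_zero_iff_int2 by blast
    then have "real_of_int j = real_of_int (2 * int n * m)" using assms by (simp add: field_simps)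
    then have "j = 2 * int n * m" by (simp only: of_int_eq_iff)
    with False show False by simp
  qed
  moreover have "sin (real n * ?t) = 0"
    using assms by (simp add: sin_zero_iff_int2)
  ultimately show ?thesis
    using sin_half_mult_lobatto_kernel[OF assms, of ?t] False by simp
qed

lemma abs_cos_diff_le: "\<bar>cos x - cos y\<bar> \<le> \<bar>x - y\<bar>" for x y :: real
proof -
  have "\<bar>cos x - cos y\<bar> = 2 * \<bar>sin ((x + y) / 2)\<bar> * \<bar>sin ((y - x) / 2)\<bar>"
    by (simp add: cos_diff_cos abs_mult)
  also have "\<dots> \<le> 2 * 1 * \<bar>(y - x) / 2\<bar>"
    by (intro mult_mono abs_sin_x_le_abs_x) auto
  finally show ?thesis by (simp add: abs_minus_commute)
qed

text \<open>Each cos (k t) is k-Lipschitz, and twice the sum of k over 1 \<le> k < n, plus n for the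
  last term, is n^2.\<close>

lemma lobatto_kernel_lipschitz:
  assumes "n \<ge> 1"
  shows "\<bar>lobatto_kernel n s - lobatto_kernel n t\<bar> \<le> real n ^ 2 * \<bar>s - t\<bar>"
proof -
  have c: "\<bar>cos (real k * s) - cos (real k * t)\<bar> \<le> real k * \<bar>s - t\<bar>" for k
    using abs_cos_diff_le[of "k * s" "k * t"] by (simp add: abs_mult flip: right_diff_distrib)
  have "\<bar>(\<Sum>k=1..<n. cos (real k * s)) - (\<Sum>k=1..<n. cos (real k * t))\<bar>
      \<le> (\<Sum>k=1..<n. real k * \<bar>s - t\<bar>)"
    unfolding sum_subtractf[symmetric] by (intro order_trans[OF sum_abs] sum_mono c)
  also have "\<dots> = (\<Sum>k=1..<n. real k) * \<bar>s - t\<bar>" by (simp add: sum_distrib_right)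
  also have "(\<Sum>k=1..<n. real k) = (real n ^ 2 - real n) / 2"
    using assms by (induction n rule: dec_induct) (auto simp: power2_eq_square field_simps)
  finally have "2 * \<bar>(\<Sum>k=1..<n. cos (real k * s)) - (\<Sum>k=1..<n. cos (real k * t))\<bar>
      \<le> (real n ^ 2 - real n) * \<bar>s - t\<bar>" by simp
  then show ?thesis
    using c[of n] unfolding lobatto_kernel_def left_diff_distrib power2_eq_square
    by (simp add: abs_if split: if_splits)
qed

section \<open>The Lagrange basis of the unmoved nodes in the angle variable\<close>

text \<open>The two end nodes get weight 1/2 because there both translates have their peak at the same
  point modulo \<open>2 \<pi>\<close>.\<close>

definition lobatto_basis :: "nat \<Rightarrow> nat \<Rightarrow> real \<Rightarrow> real" where
  "lobatto_basis n i t = (if i = 0 \<or> i = n then 1 / 2 else 1) / (2 * real n) *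
     (lobatto_kernel n (t - real i * pi / real n) + lobatto_kernel n (t + real i * pi / real n))"

text \<open>Chebyshev polynomials of the first kind; they serve to turn cosine sums in t into
  polynomials in cos t.\<close>

fun cheb_poly :: "nat \<Rightarrow> real poly" where
  "cheb_poly 0 = 1"
| "cheb_poly (Suc 0) = [:0, 1:]"
| "cheb_poly (Suc (Suc k)) = [:0, 2:] * cheb_poly (Suc k) - cheb_poly k"

lemma degree_cheb_poly_le: "degree (cheb_poly k) \<le> k"
proof (induction k rule: cheb_poly.induct)
  case (3 k)
  have "degree ([:0, 2:] * cheb_poly (Suc k)) \<le> Suc (Suc k)"
    using 3(1) by (intro order_trans[OF degree_mult_le]) simp
  with 3(2) show ?case by (simp only: cheb_poly.simps) (intro degree_diff_le; simp)
qed auto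

lemma poly_cheb_poly_cos: "poly (cheb_poly k) (cos t) = cos (real k * t)"
proof (induction k rule: cheb_poly.induct)
  case (3 k)
  have "cos (a + t) = 2 * cos t * cos a - cos (a - t)" for a
    by (simp add: cos_add cos_diff)
  from this[of "(1 + real k) * t"] 3 show ?case by (simp add: algebra_simps)
qed auto

text \<open>Adding the translates by \<theta> and -\<theta> cancels the sine parts, so only products
  cos (k \<theta>) cos (k t) with k \<le> n remain, and cos (k t) is a polynomial of degree at most
  k in cos t.\<close>

lemma lobatto_basis_eq_poly:
  assumes "n \<ge> 1"
  obtains q where "degree q \<le> n" "\<And>t. poly q (cos t) = lobatto_basis n i t"
proof
  define \<theta> where "\<theta> = real i * pi / real n"
  \<comment> \<open>The 2 in \<open>2 * real n\<close> is absent here because it cancels against the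
    2 of the product formula \<open>p\<close>.\<close>
  define c where "c = (if i = 0 \<or> i = n then 1 / 2 else 1) / real n"
  let ?q = "smult c (1 + smult 2 (\<Sum>k=1..<n. smult (cos (real k * \<theta>)) (cheb_poly k))
      + smult (cos (real n * \<theta>)) (cheb_poly n))"
  have T: "degree (smult a (cheb_poly k)) \<le> n" if "k \<le> n" for a k
    using that degree_cheb_poly_le[of k] by (meson degree_smult_le order_trans)
  have "degree (\<Sum>k=1..<n. smult (cos (real k * \<theta>)) (cheb_poly k)) \<le> n"
    by (intro degree_sum_le T) auto
  then have "degree (smult 2 (\<Sum>k=1..<n. smult (cos (real k * \<theta>)) (cheb_poly k))) \<le> n"
    by (meson degree_smult_le order_trans)
  then have "degree (1 + smult 2 (\<Sum>k=1..<n. smult (cos (real k * \<theta>)) (cheb_poly k))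
      + smult (cos (real n * \<theta>)) (cheb_poly n)) \<le> n"
    by (intro degree_add_le T) simp_all
  then show "degree ?q \<le> n" by (meson degree_smult_le order_trans)
  fix t
  have p: "cos (real k * (t - \<theta>)) + cos (real k * (t + \<theta>)) = 2 * (cos (real k * \<theta>) * cos (real k * t))" for k
    by (simp add: right_diff_distrib distrib_left cos_add cos_diff)
  have "lobatto_kernel n (t - \<theta>) + lobatto_kernel n (t + \<theta>)
      = 2 + 2 * (\<Sum>k=1..<n. cos (real k * (t - \<theta>)) + cos (real k * (t + \<theta>)))
        + (cos (real n * (t - \<theta>)) + cos (real n * (t + \<theta>)))"
    by (simp add: lobatto_kernel_def sum.distrib)
  also have "\<dots> = 2 * (1 + 2 * (\<Sum>k=1..<n. cos (real k * \<theta>) * cos (real k * t))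
        + cos (real n * \<theta>) * cos (real n * t))"
    unfolding p by (simp add: sum_distrib_left)
  finally have e: "lobatto_kernel n (t - \<theta>) + lobatto_kernel n (t + \<theta>) = \<dots>" .
  have "lobatto_basis n i t = c / 2 * (lobatto_kernel n (t - \<theta>) + lobatto_kernel n (t + \<theta>))"
    unfolding lobatto_basis_def c_def \<theta>_def by simp
  then show "poly ?q (cos t) = lobatto_basis n i t"
    unfolding e by (simp add: poly_sum poly_cheb_poly_cos algebra_simps)
qed

text \<open>The kernels are evaluated at (j - i) pi / n and (j + i) pi / n. As |j - i| < 2 n, the
  first is at a peak only for i = j. As 0 \<le> j + i \<le> 2 n, the second is at a peak only for i
  = j = 0 or i = j = n; both then contribute 2 n and the weight 1/2 compensates.\<close>

lemma lobatto_basis_node: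
  assumes "n \<ge> 1" "i \<le> n" "j \<le> n"
  shows "lobatto_basis n i (real j * pi / real n) = (if i = j then 1 else 0)"
proof -
  have m: "real j * pi / real n - real i * pi / real n = of_int (int j - int i) * pi / real n"
    "real j * pi / real n + real i * pi / real n = of_int (int j + int i) * pi / real n"
    by (simp_all add: left_diff_distrib distrib_right diff_divide_distrib add_divide_distrib)
  have minus: "2 * int n dvd int j - int i \<longleftrightarrow> i = j"
  proof
    assume "2 * int n dvd int j - int i"
    with zdvd_not_zless[of "\<bar>int j - int i\<bar>" "2 * int n"] assms show "i = j" by fastforce
  qed auto
  have plus: "2 * int n dvd int j + int i \<longleftrightarrow> i = j \<and> (i = 0 \<or> i = n)"
  proof
    assume d: "2 * int n dvd int j + int i"
    show "i = j \<and> (i = 0 \<or> i = n)"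
    proof (cases "int j + int i = 0 \<or> int j + int i = 2 * int n")
      case False
      with assms zdvd_not_zless[of "int j + int i" "2 * int n"] d show ?thesis by simp
    qed (use assms in auto)
  qed auto
  show ?thesis
    unfolding lobatto_basis_def m lobatto_kernel_node[OF assms(1)] minus plus
    using assms(1) by auto
qed

lemma lobatto_basis_lipschitz:
  assumes "n \<ge> 1"
  shows "\<bar>lobatto_basis n i s - lobatto_basis n i t\<bar> \<le> real n * \<bar>s - t\<bar>"
proof -
  let ?\<theta> = "real i * pi / real n" and ?D = "lobatto_kernel n"
  let ?c = "(if i = 0 \<or> i = n then 1 / 2 else 1) / (2 * real n)"
  have "lobatto_basis n i s - lobatto_basis n i t
      = ?c * ((?D (s - ?\<theta>) - ?D (t - ?\<theta>)) + (?D (s + ?\<theta>) - ?D (t + ?\<theta>)))"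
    unfolding lobatto_basis_def right_diff_distrib[symmetric] by (simp add: algebra_simps)
  then have "\<bar>lobatto_basis n i s - lobatto_basis n i t\<bar>
      = ?c * \<bar>(?D (s - ?\<theta>) - ?D (t - ?\<theta>)) + (?D (s + ?\<theta>) - ?D (t + ?\<theta>))\<bar>"
    by (simp only: abs_mult) simp
  also have "\<dots> \<le> 1 / (2 * real n) * (real n ^ 2 * \<bar>s - t\<bar> + real n ^ 2 * \<bar>s - t\<bar>)"
  proof (rule mult_mono)
    show "\<bar>(?D (s - ?\<theta>) - ?D (t - ?\<theta>)) + (?D (s + ?\<theta>) - ?D (t + ?\<theta>))\<bar>
        \<le> real n ^ 2 * \<bar>s - t\<bar> + real n ^ 2 * \<bar>s - t\<bar>"
      using lobatto_kernel_lipschitz[OF assms, of "s - ?\<theta>" "t - ?\<theta>"]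
        lobatto_kernel_lipschitz[OF assms, of "s + ?\<theta>" "t + ?\<theta>"]
      by (intro order_trans[OF abs_triangle_ineq] add_mono) simp_all
  qed (use assms in \<open>auto simp: field_simps\<close>)
  also have "\<dots> = real n * \<bar>s - t\<bar>"
    using assms by (simp add: power2_eq_square)
  finally show ?thesis .
qed

text \<open>Both sides are polynomials of degree at most n in cos t that agree at n + 1 nodes, whose
  distinctness is \<open>card_cheb_lobatto\<close> for vanishing parameters.\<close>

lemma lobatto_interpolation:
  assumes "n \<ge> 1" "degree p \<le> n"
  shows "poly p (cos t) = (\<Sum>i=0..n. poly p (cos (real i * pi / real n)) * lobatto_basis n i t)"
proof -
  let ?x = "\<lambda>i. cos (real i * pi / real n)"
  have "\<forall>i. \<exists>q. degree q \<le> n \<and> (\<forall>t. poly q (cos t) = lobatto_basis n i t)"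
    using lobatto_basis_eq_poly[OF assms(1)] by metis
  then obtain q where q: "\<And>i. degree (q i) \<le> n" "\<And>i t. poly (q i) (cos t) = lobatto_basis n i t"
    by metis
  define r where "r = (\<Sum>i=0..n. smult (poly p (?x i)) (q i))"
  have card: "card (?x ` {0..n}) = n + 1"
    using card_cheb_lobatto[OF assms(1), of 0 0] by (simp add: cheb_lobatto_def)
  have "p = r"
  proof (rule poly_eqI_degree)
    fix y assume "y \<in> ?x ` {0..n}"
    then obtain j where j: "j \<le> n" "y = ?x j" by auto
    have "poly r y = (\<Sum>i=0..n. if i = j then poly p (?x i) else 0)"
      unfolding r_def poly_sum j(2) poly_smult q(2)
      using lobatto_basis_node[OF assms(1)] j(1) by (intro sum.cong) auto
    then show "poly p y = poly r y" using j by simp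
  next
    have "degree r \<le> n" unfolding r_def
      by (intro degree_sum_le order_trans[OF degree_smult_le] q) auto
    then show "card (?x ` {0..n}) > degree p" "card (?x ` {0..n}) > degree r"
      unfolding card using assms(2) by auto
  qed
  then have "poly p (cos t) = poly r (cos t)" by simp
  then show ?thesis by (simp add: r_def poly_sum q(2))
qed

section \<open>The logarithmic bound for the unmoved nodes\<close>

text \<open>Jordan's inequality: the concave sine lies above its chord over [0, pi / 2].\<close>

lemma two_div_pi_mult_le_sin:
  fixes x :: real
  assumes "0 \<le> x" "x \<le> pi / 2"
  shows "2 / pi * x \<le> sin x"
proof -
  have "concave_on {0..pi / 2} sin"
  proof (rule f''_le0_imp_concave)
    show "(sin has_real_derivative cos y) (at y)" for y :: real by (rule DERIV_sin)
    show "(cos has_real_derivative - sin y) (at y)" for y :: real by (rule DERIV_cos)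
    show "- sin y \<le> 0" if "y \<in> {0..pi / 2}" for y :: real
      using that by (auto intro!: sin_ge_zero)
  qed auto
  from concave_onD[OF this, of "2 / pi * x" 0 "pi / 2"] show ?thesis
    using assms by (simp add: field_simps)
qed

lemma abs_lobatto_basis_le:
  assumes "n \<ge> 1"
  shows "\<bar>lobatto_basis n i t\<bar> \<le> (\<bar>lobatto_kernel n (t - real i * pi / real n)\<bar> +
           \<bar>lobatto_kernel n (t + real i * pi / real n)\<bar>) / (2 * real n)"
proof -
  let ?D = "lobatto_kernel n (t - real i * pi / real n) + lobatto_kernel n (t + real i * pi / real n)"
  have "\<bar>lobatto_basis n i t\<bar> = (if i = 0 \<or> i = n then 1 / 2 else 1) / (2 * real n) * \<bar>?D\<bar>"
    unfolding lobatto_basis_def by (simp only: abs_mult) simp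
  also have "\<dots> \<le> 1 / (2 * real n) * \<bar>?D\<bar>"
    by (intro mult_right_mono divide_right_mono) auto
  also have "\<dots> \<le> 1 / (2 * real n) * (\<bar>lobatto_kernel n (t - real i * pi / real n)\<bar> +
           \<bar>lobatto_kernel n (t + real i * pi / real n)\<bar>)"
    by (intro mult_left_mono abs_triangle_ineq) auto
  finally show ?thesis by simp
qed

text \<open>Serves the two nodes next to t, where a bound by the inverse distance is
  useless.\<close>

lemma abs_lobatto_basis_le_2:
  assumes "n \<ge> 1"
  shows "\<bar>lobatto_basis n i t\<bar> \<le> 2"
proof -
  have "\<bar>lobatto_basis n i t\<bar> \<le> (2 * real n + 2 * real n) / (2 * real n)"
    by (intro order_trans[OF abs_lobatto_basis_le] divide_right_mono add_mono lobatto_kernel_bound)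
      (use assms in auto)
  then show ?thesis using assms by simp
qed

text \<open>Here d is the distance of t from the node in units of the spacing pi / n. Jordan's
  inequality gives |sin ((t - \<theta>) / 2)| \<ge> d / n, and |sin ((t + \<theta>) / 2)| is no
  smaller, so each kernel is at most n / d before the division by 2 n.\<close>

lemma abs_lobatto_basis_le_inverse:
  assumes "n \<ge> 1" "i \<le> n" "0 \<le> t" "t \<le> pi" "d > 0" "d * pi / real n \<le> \<bar>t - real i * pi / real n\<bar>"
  shows "\<bar>lobatto_basis n i t\<bar> \<le> 1 / d"
proof -
  define \<theta> where "\<theta> = real i * pi / real n"
  have \<theta>: "0 \<le> \<theta>" "\<theta> \<le> pi" using assms by (auto simp: \<theta>_def field_simps)
  have "d / real n \<le> 2 / pi * (\<bar>t - \<theta>\<bar> / 2)"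
    using assms(6) pi_gt_zero assms(1) unfolding \<theta>_def[symmetric] by (simp add: field_simps)
  also have "\<dots> \<le> sin (\<bar>t - \<theta>\<bar> / 2)"
    using \<theta> assms by (intro two_div_pi_mult_le_sin) auto
  finally have lower: "d / real n \<le> sin (\<bar>t - \<theta>\<bar> / 2)" .
  also have "sin (\<bar>t - \<theta>\<bar> / 2) \<le> \<bar>sin ((t - \<theta>) / 2)\<bar>"
  proof -
    have "\<bar>t - \<theta>\<bar> = t - \<theta> \<or> \<bar>t - \<theta>\<bar> = - (t - \<theta>)" by linarith
    then have "sin (\<bar>t - \<theta>\<bar> / 2) \<in> {sin ((t - \<theta>) / 2), - sin ((t - \<theta>) / 2)}"
      by (metis insert_iff minus_divide_left sin_minus)
    then show ?thesis by auto
  qed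
  finally have minus: "d / real n \<le> \<bar>sin ((t - \<theta>) / 2)\<bar>" .
  \<comment> \<open>By the addition formulas sin ((t + \<theta>) / 2) is the sum of these two
    products and sin (|t - \<theta>| / 2) is, up to sign, their difference.\<close>
  have prod: "0 \<le> cos (t / 2) * sin (\<theta> / 2)" "0 \<le> sin (t / 2) * cos (\<theta> / 2)"
    using \<theta> assms by (auto intro!: mult_nonneg_nonneg cos_ge_zero sin_ge_zero)
  then have "sin (\<bar>t - \<theta>\<bar> / 2) \<le> sin ((t + \<theta>) / 2)"
    by (cases "t \<ge> \<theta>") (simp_all add: abs_if add_divide_distrib diff_divide_distrib sin_add sin_diff mult.commute)
  with lower have plus: "d / real n \<le> \<bar>sin ((t + \<theta>) / 2)\<bar>" by linarith
  have "d / real n > 0" using assms by simp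
  then have "\<bar>lobatto_basis n i t\<bar> \<le> (1 / (d / real n) + 1 / (d / real n)) / (2 * real n)"
    using abs_lobatto_kernel_le_inverse_sin[OF assms(1) _ minus]
      abs_lobatto_kernel_le_inverse_sin[OF assms(1) _ plus]
    unfolding \<theta>_def
    by (intro order_trans[OF abs_lobatto_basis_le[OF assms(1)]] divide_right_mono add_mono) auto
  also have "\<dots> = 1 / d" using assms by (simp add: field_simps)
  finally show ?thesis .
qed

text \<open>Meant for the nodes on one side of t, whose index distances, shifted by one, are
  distinct elements of \<open>{1..N}\<close>.\<close>

lemma sum_inverse_reindex_le_harm:
  assumes "inj_on g A" "g ` A \<subseteq> {1..N}"
  shows "(\<Sum>i\<in>A. 1 / real (g i)) \<le> harm N"
proof -
  have "(\<Sum>i\<in>A. 1 / real (g i)) = (\<Sum>k\<in>g ` A. 1 / real k)"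
    using assms(1) by (simp add: sum.reindex)
  also have "\<dots> \<le> (\<Sum>k=1..N. 1 / real k)"
    using assms(2) by (intro sum_mono2) auto
  finally show ?thesis by (simp add: harm_def inverse_eq_divide)
qed

lemma sum_abs_lobatto_basis_le:
  assumes "n \<ge> 1" "0 \<le> t" "t \<le> pi"
  shows "(\<Sum>i=0..n. \<bar>lobatto_basis n i t\<bar>) \<le> 8 * harm (n + 1)"
proof -
  \<comment> \<open>The last unmoved node at or before t.\<close>
  define m where "m = nat \<lfloor>t * real n / pi\<rfloor>"
  have "0 \<le> t * real n / pi" using assms by simp
  then have m: "real m \<le> t * real n / pi" "t * real n / pi < real m + 1"
    unfolding m_def by linarith+
  have "t * real n / pi \<le> real n"
    using assms pi_gt_zero by (simp add: field_simps)
  then have "m \<le> n" using m(1) by linarith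
  have diff: "t - real i * pi / real n = (t * real n / pi - real i) * pi / real n" for i
    using assms(1) by (simp add: field_simps)
  have far: "\<bar>lobatto_basis n i t\<bar> \<le> 1 / d"
    if "i \<le> n" "d > 0" "d \<le> \<bar>t * real n / pi - real i\<bar>" for i d
  proof (rule abs_lobatto_basis_le_inverse)
    have "d * pi / real n \<le> \<bar>t * real n / pi - real i\<bar> * pi / real n"
      using that by (intro divide_right_mono mult_right_mono) auto
    then show "d * pi / real n \<le> \<bar>t - real i * pi / real n\<bar>"
      unfolding diff by (simp add: abs_mult)
  qed (use that assms in auto)
  \<comment> \<open>Node m may be arbitrarily close to t and takes the bound 2; for i < m the
    distance is at least m - i spacings.\<close>
  have left: "\<bar>lobatto_basis n i t\<bar> \<le> 4 * (1 / real (m - i + 1))" if "i \<in> {0..m}" for i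
  proof (cases "i = m")
    case True
    then show ?thesis using abs_lobatto_basis_le_2[OF assms(1), of i t] by simp
  next
    case False
    with that have i: "i < m" by simp
    have "\<bar>lobatto_basis n i t\<bar> \<le> 1 / (real m - real i)"
      using m i \<open>m \<le> n\<close> by (intro far) auto
    also have "\<dots> \<le> 4 * (1 / real (m - i + 1))"
      using i by (simp add: of_nat_diff divide_simps)
    finally show ?thesis .
  qed
  \<comment> \<open>Since t is only known to lie before node m + 1, one spacing is lost and the
    distance is at least i - m - 1. Node m + 1 takes the bound 2 = 4 * (1 / 2), which fixes the
    constant 4.\<close>
  have right: "\<bar>lobatto_basis n i t\<bar> \<le> 4 * (1 / real (i - m + 1))" if "i \<in> {m<..n}" for i
  proof (cases "i = m + 1")
    case True
    then show ?thesis using abs_lobatto_basis_le_2[OF assms(1), of i t] by simp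
  next
    case False
    with that have i: "m + 2 \<le> i" "i \<le> n" by simp_all
    then have i': "real m + 2 \<le> real i" by linarith
    have "\<bar>lobatto_basis n i t\<bar> \<le> 1 / (real i - real m - 1)"
      using m i i' by (intro far) auto
    also have "\<dots> \<le> 4 * (1 / real (i - m + 1))"
      using i i' by (simp add: of_nat_diff divide_simps)
    finally show ?thesis .
  qed
  have "{0..n} = {0..m} \<union> {m<..n}" using \<open>m \<le> n\<close> by auto
  then have "(\<Sum>i=0..n. \<bar>lobatto_basis n i t\<bar>)
      = (\<Sum>i\<in>{0..m}. \<bar>lobatto_basis n i t\<bar>) + (\<Sum>i\<in>{m<..n}. \<bar>lobatto_basis n i t\<bar>)"
    by (simp only:) (intro sum.union_disjoint; auto)
  also have "\<dots> \<le> (\<Sum>i\<in>{0..m}. 4 * (1 / real (m - i + 1))) + (\<Sum>i\<in>{m<..n}. 4 * (1 / real (i - m + 1)))"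
    by (intro add_mono sum_mono left right)
  also have "\<dots> = 4 * (\<Sum>i\<in>{0..m}. 1 / real (m - i + 1)) + 4 * (\<Sum>i\<in>{m<..n}. 1 / real (i - m + 1))"
    by (simp only: sum_distrib_left)
  \<comment> \<open>The denominators run through 1, ..., m + 1 on the left and 2, ..., n - m + 1 on
    the right, all within 1, ..., n + 1.\<close>
  also have "\<dots> \<le> 4 * harm (n + 1) + 4 * harm (n + 1)"
    using \<open>m \<le> n\<close> by (intro add_mono mult_left_mono sum_inverse_reindex_le_harm inj_onI) auto
  finally show ?thesis by simp
qed

text \<open>The increment 1 / (m + 1) is at most ln (m + 1) - ln m, by ln x \<le> x - 1 at x = m /
  (m + 1).\<close>

lemma harm_le_1_plus_ln: "n \<ge> 1 \<Longrightarrow> harm n \<le> 1 + ln (real n)"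
proof (induction n rule: dec_induct)
  case base
  then show ?case by (simp add: harm_def)
next
  case (step m)
  have "ln (real m / real (Suc m)) \<le> real m / real (Suc m) - 1"
    using step by (intro ln_le_minus_one) simp
  moreover have "ln (real m / real (Suc m)) = ln (real m) - ln (real (Suc m))"
    using step by (intro ln_divide_pos) auto
  moreover have "real m / real (Suc m) - 1 = - inverse (real (Suc m))"
    by (simp add: field_simps)
  ultimately show ?case using step.IH by (simp add: harm_Suc)
qed

section \<open>Stability under moving the nodes\<close>

text \<open>Only the values of p at the unmoved nodes are estimated, in terms of their own maximum
  \<open>A\<close>, so the Lagrange basis of the moved nodes never enters. Interpolation at the
  unmoved nodes then costs \<open>8 * harm (n + 1)\<close> times \<open>A \<le> 2\<close>.\<close>

lemma poly_bound_of_perturbed_nodes: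
  assumes "n \<ge> 1" "degree p \<le> n"
    and near: "\<And>j. j \<le> n \<Longrightarrow> \<bar>s j - real j * pi / real n\<bar> \<le> \<epsilon>"
    and small: "(real n + 1) * real n * \<epsilon> \<le> 1 / 2"
    and bound: "\<And>j. j \<le> n \<Longrightarrow> \<bar>poly p (cos (s j))\<bar> \<le> 1"
    and x: "x \<in> {-1..1}"
  shows "\<bar>poly p x\<bar> \<le> 16 * harm (n + 1)"
proof -
  define v where "v j = poly p (cos (real j * pi / real n))" for j
  define A where "A = Max ((\<lambda>j. \<bar>v j\<bar>) ` {0..n})"
  have A: "\<bar>v j\<bar> \<le> A" if "j \<le> n" for j
    unfolding A_def using that by (intro Max_ge) auto
  have "A \<in> (\<lambda>j. \<bar>v j\<bar>) ` {0..n}" unfolding A_def by (intro Max_in) auto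
  then obtain j where j: "j \<le> n" "A = \<bar>v j\<bar>" by auto
  have "A \<ge> 0" using j by simp
  have \<epsilon>: "\<epsilon> \<ge> 0" using near[of 0] by simp
  have expand: "poly p (cos t) = (\<Sum>i=0..n. v i * lobatto_basis n i t)" for t
    unfolding v_def by (rule lobatto_interpolation[OF assms(1,2)])
  \<comment> \<open>At the index j where \<open>A\<close> is attained, both values are expanded by
    interpolation at the unmoved nodes; the Lipschitz bound makes each of the n + 1 terms at most A
    n \<epsilon>.\<close>
  have "v j - poly p (cos (s j))
      = (\<Sum>i=0..n. v i * (lobatto_basis n i (real j * pi / real n) - lobatto_basis n i (s j)))"
    unfolding v_def[of j] expand by (simp add: right_diff_distrib sum_subtractf)
  also have "\<bar>\<dots>\<bar> \<le> (\<Sum>i=0..n. A * (real n * \<epsilon>))"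
  proof (intro order_trans[OF sum_abs] sum_mono)
    fix i assume i: "i \<in> {0..n}"
    have "\<bar>lobatto_basis n i (real j * pi / real n) - lobatto_basis n i (s j)\<bar> \<le> real n * \<epsilon>"
      using near[OF j(1)]
      by (intro order_trans[OF lobatto_basis_lipschitz[OF assms(1)]] mult_left_mono)
        (auto simp: abs_minus_commute)
    then show "\<bar>v i * (lobatto_basis n i (real j * pi / real n) - lobatto_basis n i (s j))\<bar>
        \<le> A * (real n * \<epsilon>)"
      unfolding abs_mult using i A \<open>A \<ge> 0\<close> by (intro mult_mono) auto
  qed
  also have "\<dots> = A * ((real n + 1) * real n * \<epsilon>)" by (simp add: algebra_simps)
  also have "\<dots> \<le> A * (1 / 2)" using small \<open>A \<ge> 0\<close> by (rule mult_left_mono)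
  finally have "A \<le> 2" using bound[OF j(1)] j(2) by linarith
  have "\<bar>poly p x\<bar> = \<bar>\<Sum>i=0..n. v i * lobatto_basis n i (arccos x)\<bar>"
    using expand[of "arccos x"] x by simp
  also have "\<dots> \<le> (\<Sum>i=0..n. 2 * \<bar>lobatto_basis n i (arccos x)\<bar>)"
    using A \<open>A \<le> 2\<close>
    by (intro order_trans[OF sum_abs] sum_mono) (force simp: abs_mult intro: mult_right_mono)
  also have "\<dots> \<le> 2 * (8 * harm (n + 1))"
    unfolding sum_distrib_left[symmetric]
    using x assms(1) by (intro mult_left_mono sum_abs_lobatto_basis_le arccos_lbound arccos_ubound) auto
  finally show ?thesis by simp
qed

section \<open>From polynomials to Lebesgue constants\<close>

text \<open>For fixed x, weight each Lagrange polynomial by the sign of its value at x. The weighted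
  sum takes these signs as values at the nodes, hence is bounded by 1 there, and at x all terms
  become absolute values.\<close>

lemma lebesgue_function_eq_poly:
  assumes "finite X" "card X = n + 1"
  obtains p where "degree p \<le> n" "\<And>a. a \<in> X \<Longrightarrow> \<bar>poly p a\<bar> \<le> 1"
    "poly p x = (\<Sum>a\<in>X. \<bar>lagrange_basis X a x\<bar>)"
proof
  define l where "l a = (\<Prod>b\<in>X - {a}. smult (1 / (a - b)) [:- b, 1:])" for a
  have l: "poly (l a) y = lagrange_basis X a y" for a y
    unfolding l_def lagrange_basis_def poly_prod
    by (intro prod.cong) (auto simp: diff_divide_distrib)
  have deg: "degree (l a) \<le> n" if "a \<in> X" for a
  proof -
    have "degree (l a) \<le> (\<Sum>b\<in>X - {a}. degree (smult (1 / (a - b)) [:- b, 1:]))"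
      unfolding l_def using degree_prod_sum_le[of "X - {a}" "\<lambda>b. smult (1 / (a - b)) [:- b, 1:]"] assms(1)
      by (simp only: o_def finite_Diff)
    also have "\<dots> \<le> (\<Sum>b\<in>X - {a}. 1)"
      by (intro sum_mono order_trans[OF degree_smult_le]) simp
    also have "\<dots> = n" using assms that by simp
    finally show ?thesis .
  qed
  let ?p = "\<Sum>a\<in>X. smult (sgn (lagrange_basis X a x)) (l a)"
  show "degree ?p \<le> n"
    by (intro degree_sum_le order_trans[OF degree_smult_le] deg assms)
  show "poly ?p x = (\<Sum>a\<in>X. \<bar>lagrange_basis X a x\<bar>)"
    by (simp add: poly_sum l abs_sgn mult.commute)
  fix c assume c: "c \<in> X"
  have "lagrange_basis X a c = (if a = c then 1 else 0)" if "a \<in> X" for a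
    using assms c by (auto simp: lagrange_basis_def intro!: prod.neutral)
  then have "poly ?p c = (\<Sum>a\<in>X. if a = c then sgn (lagrange_basis X a x) else 0)"
    unfolding poly_sum by (intro sum.cong) (auto simp: l)
  also have "\<dots> = sgn (lagrange_basis X c x)"
    using assms c by simp
  finally show "\<bar>poly ?p c\<bar> \<le> 1" by (simp add: abs_sgn_eq)
qed

lemma lebesgue_constant_cheb_lobatto_le:
  assumes "n \<ge> 1" "0 \<le> \<beta>" "0 \<le> \<gamma>" "\<beta> + \<gamma> < 2"
    and small: "(real n + 1) * real n * (max \<beta> \<gamma> * pi / 2) \<le> 1 / 2"
  shows "lebesgue_constant (cheb_lobatto \<beta> \<gamma> n) {-1..1} \<le> 16 * harm (n + 1)"
  unfolding lebesgue_constant_def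
proof (rule cSUP_least)
  fix x :: real assume x: "x \<in> {-1..1}"
  let ?X = "cheb_lobatto \<beta> \<gamma> n"
  define s where "s j = (2 - \<beta> - \<gamma>) * real j * pi / (2 * real n) + \<gamma> * pi / 2" for j
  have X: "?X = (\<lambda>j. cos (s j)) ` {0..n}" by (simp add: cheb_lobatto_def s_def)
  have fin: "finite ?X" by (simp add: X)
  obtain p where p: "degree p \<le> n" "\<And>a. a \<in> ?X \<Longrightarrow> \<bar>poly p a\<bar> \<le> 1"
    "poly p x = (\<Sum>a\<in>?X. \<bar>lagrange_basis ?X a x\<bar>)"
    using lebesgue_function_eq_poly[OF fin card_cheb_lobatto[OF assms(1-4)], of x] by blast
  \<comment> \<open>With u = j / n the displacement is pi / 2 times \<gamma> (1 - u) - \<beta> u, a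
    difference of two nonnegative numbers neither of which exceeds the larger parameter.\<close>
  have near: "\<bar>s j - real j * pi / real n\<bar> \<le> max \<beta> \<gamma> * pi / 2" if "j \<le> n" for j
  proof -
    define u where "u = real j / real n"
    have u: "0 \<le> u" "u \<le> 1" using that assms(1) by (auto simp: u_def)
    have "s j - real j * pi / real n = (\<gamma> * (1 - u) - \<beta> * u) * (pi / 2)"
      using assms(1) by (simp add: s_def u_def field_simps)
    moreover have "\<bar>\<gamma> * (1 - u) - \<beta> * u\<bar> \<le> max \<beta> \<gamma>"
    proof -
      have "0 \<le> \<gamma> * (1 - u)" "0 \<le> \<beta> * u" "\<gamma> * (1 - u) \<le> \<gamma> * 1" "\<beta> * u \<le> \<beta> * 1"
        using u assms by (auto simp del: mult_1_right intro: mult_left_mono)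
      then show ?thesis by linarith
    qed
    ultimately have "\<bar>s j - real j * pi / real n\<bar> \<le> max \<beta> \<gamma> * (pi / 2)"
      by (simp only: abs_mult) (intro mult_mono; simp)
    then show ?thesis by simp
  qed
  have "\<bar>poly p x\<bar> \<le> 16 * harm (n + 1)"
    using p(2) X by (intro poly_bound_of_perturbed_nodes[OF assms(1) p(1) near small _ x]) auto
  then show "(\<Sum>a\<in>?X. \<bar>lagrange_basis ?X a x\<bar>) \<le> 16 * harm (n + 1)"
    unfolding p(3) by linarith
qed auto

section \<open>Asymptotics under the hypothesis on \<delta>\<close>

lemma lebesgue_constant_nonneg:
  assumes "compact \<Omega>" "\<Omega> \<noteq> {}"
  shows "lebesgue_constant X \<Omega> \<ge> 0"
  using lebesgue_constant_attained[OF assms, of X] by (metis abs_ge_zero sum_nonneg)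

theorem theorem3:
  fixes \<beta> \<gamma> \<delta> :: "nat \<Rightarrow> real"
  assumes "\<And>n. n \<ge> 1 \<Longrightarrow> 0 \<le> \<beta> n \<and> \<beta> n < 2"
    and "\<And>n. n \<ge> 1 \<Longrightarrow> 0 \<le> \<gamma> n \<and> \<gamma> n < 2"
    and "\<And>n. n \<ge> 1 \<Longrightarrow> \<beta> n + \<gamma> n < 2"
    and "\<And>n. n \<ge> 1 \<Longrightarrow> \<delta> n = max (\<beta> n) (\<gamma> n)"
    and "\<And>n. n \<ge> 1 \<Longrightarrow> \<delta> n < 4 / (pi * real n ^ 2 * (2 + pi * ln (real n + 1)))"
  shows "(\<lambda>n. lebesgue_constant (cheb_lobatto (\<beta> n) (\<gamma> n) n) {-1..1}) \<in> O(\<lambda>n. ln (real n))"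
proof (rule bigoI)
  let ?L = "\<lambda>n. lebesgue_constant (cheb_lobatto (\<beta> n) (\<gamma> n) n) {-1..1}"
  show "\<forall>\<^sub>F n in sequentially. norm (?L n) \<le> 32 * norm (ln (real n))"
    \<comment> \<open>From exp 2 on, ln n \<ge> 2. This gives pi ln (n + 1) \<ge> 6, so that the
      hypothesis yields 4 / (2 + 6) = 1 / 2, and it absorbs the constant at the end: 16 (2 + ln n)
      \<le> 32 ln n.\<close>
    using eventually_ge_at_top[of "nat \<lceil>exp 2 :: real\<rceil>"]
  proof eventually_elim
    case (elim n)
    then have large: "real n \<ge> exp 2" by linarith
    then have "real n > 0" using exp_gt_zero[of "2 :: real"] by linarith
    then have n: "n \<ge> 1" "real n \<ge> 1" by auto
    have ln: "ln (real n) \<ge> 2" using large \<open>real n > 0\<close> by (simp add: ln_ge_iff)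
    have "ln (real n) \<le> ln (real n + 1)" using n by simp
    with ln have ln1: "ln (real n + 1) \<ge> 2" by linarith
    define c where "c = pi * ln (real n + 1)"
    have "3 * 2 \<le> c"
      unfolding c_def using ln1 pi_gt3 by (intro mult_mono) auto
    \<comment> \<open>Replacing n + 1 by 2 n produces pi n^2 \<delta>, whose factor pi n^2 cancels
      in the hypothesis.\<close>
    have "(real n + 1) * real n * (\<delta> n * pi / 2) \<le> (2 * real n) * real n * (\<delta> n * pi / 2)"
      using n assms(1,2,4)[OF n(1)] by (intro mult_right_mono) auto
    also have "\<dots> = (pi * real n ^ 2) * \<delta> n" by (simp add: power2_eq_square)
    also have "\<dots> \<le> (pi * real n ^ 2) * (4 / (pi * real n ^ 2 * (2 + c)))"
      using assms(5)[OF n(1)] unfolding c_def by (intro mult_left_mono) auto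
    also have "\<dots> = 4 / (2 + c)" using n by simp
    also have "\<dots> \<le> 4 / (2 + 3 * 2)"
      using \<open>3 * 2 \<le> c\<close> by (intro divide_left_mono) auto
    finally have small: "(real n + 1) * real n * (max (\<beta> n) (\<gamma> n) * pi / 2) \<le> 1 / 2"
      unfolding assms(4)[OF n(1)] by simp
    have "?L n \<le> 16 * harm (n + 1)"
      using n assms(1-3)[OF n(1)] small by (intro lebesgue_constant_cheb_lobatto_le) auto
    also have "harm (n + 1) \<le> 1 + ln (real n + 1)"
      using harm_le_1_plus_ln[of "n + 1"] by (simp add: add.commute)
    also have "ln (real n + 1) \<le> ln (exp 1 * real n)"
    proof -
      have "real n + 1 \<le> 2 * real n" using n by simp
      also have "\<dots> \<le> exp 1 * real n"
        using exp_ge_add_one_self[of 1] by (intro mult_right_mono) auto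
      finally have "real n + 1 \<le> exp 1 * real n" .
      then show ?thesis using n by (subst ln_le_cancel_iff) auto
    qed
    also have "\<dots> = 1 + ln (real n)" using n by (simp add: ln_mult)
    finally have "?L n \<le> 32 * ln (real n)" using ln by simp
    moreover have "?L n \<ge> 0" by (intro lebesgue_constant_nonneg) auto
    ultimately show ?case using ln by simp
  qed
qed

end
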